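(* Let $C$ be a germ of a reduced singular curve at $0\in\mathbb{C}^2$ defined by a weighted homogeneous polynomial $f\in\mathbb{C}[x,y]$ of weight type $(w_1,w_2;1)$ such that $\nu(f)\ge 1/w_1$. Then for every integer $k\ge 0$, $$\tau^k(C)\ \ge\ \ell^k\!\left(\frac1{w_1},\frac1{w_2}\right).$$
   Context: $\mathcal{O}_2=\mathbb{C}\{x,y\}$ is the ring of germs of holomorphic functions at $0\in\mathbb{C}^2$, $\mathfrak{m}$ is its maximal ideal, and $\mathfrak{m}^0=\mathcal{O}_2$. $\nu(f)$ is the algebraic multiplicity (order of vanishing) of $f$ at $0$. For $C=\{f=0\}$ with $f$ reduced, $\tau^k(C)=\dim_{\mathbb{C}}\mathcal{O}_2/(\mathfrak{m}^k\langle f_x,f_y\rangle+\langle f\rangle)$. A polynomial $f$ is weighted homogeneous of weight type $(w_1,w_2;1)$, with $w_1,w_2$ positive rational numbers, if every monomial $x^iy^j$ occurring in $f$ satisfies $w_1i+w_2j=1$. The number $\ell^k(a_1,a_2)$ denotes the $k$-th Tjurina number of the Brieskorn curve $\{x^{a_1}+y^{a_2}=0\}$, expressed as a function of the exponents and evaluated at the (possibly non-integral) rational numbers $a_1=1/w_1$, $a_2=1/w_2$; explicitly, $$\ell^{k}\!\left(\tfrac1{w_1},\tfrac1{w_2}\right)=\begin{cases}\left(\frac{1}{w_1}-1\right)\left(\frac{1}{w_2}-1\right)+\frac{k(k+3)}{2}, & \text{if } 0\le k<1/w_1,\\[4pt] \left(\frac{1}{w_1}-1\right)\left(\frac{1}{w_2}-1\right)+\frac{k(k+3)}{2}-\frac{\left(k-\frac{1}{w_1}+2\right)\left(k-\frac{1}{w_1}+1\right)}{2},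 & \text{if } k\ge 1/w_1.\end{cases}$$ *)

theory Defs
  imports
    "HOL-Analysis.Analysis"
    "HOL-Computational_Algebra.Computational_Algebra"
begin

section \<open>The ring of convergent power series in two variables\<close>

text \<open>
  Both \<^typ>\<open>complex poly poly\<close> and \<^typ>\<open>complex fps fps\<close> are read with the outer variable
  \<open>x\<close> and the inner variable \<open>y\<close>: the coefficient of \<open>x\<^sup>i y\<^sup>j\<close> is \<open>coeff (coeff f i) j\<close>,
  respectively \<open>F $ i $ j\<close>.

  A germ at the origin of a holomorphic function of two variables is identified with its Taylor
  series, i.e. with a power series that converges absolutely on some polydisc around the origin.
\<close>

unbundle no vec_syntax
unbundle fps_syntax

definition convergent_fps2 :: "complex fps fps \<Rightarrow> bool" where
  "convergent_fps2 F \<longleftrightarrow>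
     (\<exists>r>0. (\<lambda>(i, j). norm (F $ i $ j) * r ^ i * r ^ j) summable_on (UNIV :: (nat \<times> nat) set))"

lemma convergent_fps2_iff:
  "convergent_fps2 F \<longleftrightarrow> (\<exists>C\<ge>0. \<exists>R\<ge>0. \<forall>i j. norm (F $ i $ j) \<le> C * R ^ (i + j))"
proof
  assume "convergent_fps2 F"
  then obtain r where r: "r > 0"
    and s: "(\<lambda>(i, j). norm (F $ i $ j) * r ^ i * r ^ j) summable_on (UNIV :: (nat \<times> nat) set)"
    unfolding convergent_fps2_def by blast
  define g where "g = (\<lambda>(i, j). norm (F $ i $ j) * r ^ i * r ^ j)"
  define C where "C = infsum g UNIV"
  have gnn: "g p \<ge> 0" for p using r by (auto simp: g_def split: prod.split)
  have le: "g p \<le> C" for p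
  proof -
    have "infsum g {p} \<le> infsum g UNIV"
      by (rule infsum_mono_neutral) (use s gnn in \<open>auto simp: g_def\<close>)
    then show ?thesis by (simp add: C_def)
  qed
  have "norm (F $ i $ j) \<le> C * (1 / r) ^ (i + j)" for i j
    using le[of "(i, j)"] r by (simp add: g_def power_add field_simps)
  moreover have "C \<ge> 0" using le[of "(0, 0)"] gnn[of "(0, 0)"] by linarith
  moreover have "1 / r \<ge> 0" using r by simp
  ultimately show "\<exists>C\<ge>0. \<exists>R\<ge>0. \<forall>i j. norm (F $ i $ j) \<le> C * R ^ (i + j)" by blast
next
  assume "\<exists>C\<ge>0. \<exists>R\<ge>0. \<forall>i j. norm (F $ i $ j) \<le> C * R ^ (i + j)"
  then obtain C R where C: "C \<ge> 0" and R: "R \<ge> 0"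
    and b: "\<And>i j. norm (F $ i $ j) \<le> C * R ^ (i + j)" by blast
  define r where "r = 1 / (2 * (R + 1))"
  have r: "r > 0" and Rr: "R * r \<le> 1 / 2" using R by (auto simp: r_def field_simps)
  have geo: "((\<lambda>n. (1 / 2 :: real) ^ n) has_sum 2) UNIV"
    using sums_nonneg_imp_has_sum[OF geometric_sums[of "1 / 2 :: real"]] by simp
  have sm: "(\<lambda>(i, j). C * (1 / 2) ^ i * (1 / 2 :: real) ^ j) summable_on
              (SIGMA i:(UNIV :: nat set). (UNIV :: nat set))"
  proof (rule summable_on_SigmaI)
    fix i :: nat
    show "((\<lambda>j. case (i, j) of (i, j) \<Rightarrow> C * (1 / 2) ^ i * (1 / 2 :: real) ^ j)
            has_sum (C * (1 / 2) ^ i * 2)) UNIV"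
      using has_sum_cmult_right[OF geo, of "C * (1 / 2) ^ i"] by simp
  next
    show "(\<lambda>i. C * (1 / 2) ^ i * 2 :: real) summable_on (UNIV :: nat set)"
      using has_sum_imp_summable[OF has_sum_cmult_right[OF geo, of "2 * C"]]
      by (simp add: mult_ac)
  qed (use C in auto)
  have "(\<lambda>(i, j). norm (F $ i $ j) * r ^ i * r ^ j) summable_on (UNIV :: (nat \<times> nat) set)"
  proof (rule summable_on_comparison_test)
    show "(\<lambda>(i, j). C * (1 / 2) ^ i * (1 / 2 :: real) ^ j) summable_on
            (UNIV :: (nat \<times> nat) set)"
      using sm by simp
  next
    fix p :: "nat \<times> nat"
    obtain i j where p: "p = (i, j)" by (cases p)
    have "norm (F $ i $ j) * (r ^ i * r ^ j) \<le> C * R ^ (i + j) * (r ^ i * r ^ j)"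
      by (rule mult_right_mono[OF b]) (use r in simp)
    also have "\<dots> = C * (R * r) ^ (i + j)" by (simp add: power_add power_mult_distrib)
    also have "\<dots> \<le> C * (1 / 2) ^ (i + j)"
      by (intro mult_left_mono power_mono Rr C) (use R r in simp)
    finally show "(case p of (i, j) \<Rightarrow> norm (F $ i $ j) * r ^ i * r ^ j) \<le>
        (case p of (i, j) \<Rightarrow> C * (1 / 2) ^ i * (1 / 2) ^ j)"
      by (simp add: p power_add mult_ac)
  qed (use r in auto)
  with r show "convergent_fps2 F" unfolding convergent_fps2_def by blast
qed

lemma convergent_fps2I:
  assumes "C \<ge> 0" "R \<ge> 0" "\<And>i j. norm (F $ i $ j) \<le> C * R ^ (i + j)"
  shows "convergent_fps2 F"
  using assms convergent_fps2_iff by blast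

lemma convergent_fps2E:
  assumes "convergent_fps2 F"
  obtains C R where "C \<ge> 0" "R \<ge> 1" "\<And>i j. norm (F $ i $ j) \<le> C * R ^ (i + j)"
proof -
  obtain C R where C: "C \<ge> 0" and R: "R \<ge> 0"
    and b: "\<And>i j. norm (F $ i $ j) \<le> C * R ^ (i + j)"
    using assms convergent_fps2_iff by blast
  have "norm (F $ i $ j) \<le> C * (R + 1) ^ (i + j)" for i j
    using b[of i j] mult_left_mono[OF power_mono[of R "R + 1" "i + j"] C] R by linarith
  with C R show thesis by (intro that[of C "R + 1"]) auto
qed

lemma convergent_fps2_add:
  assumes "convergent_fps2 F" "convergent_fps2 G"
  shows "convergent_fps2 (F + G)"
proof -
  obtain C R where C: "C \<ge> 0" "R \<ge> 1" and F: "\<And>i j. norm (F $ i $ j) \<le> C * R ^ (i + j)"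
    using assms(1) by (rule convergent_fps2E) blast
  obtain D S where D: "D \<ge> 0" "S \<ge> 1" and G: "\<And>i j. norm (G $ i $ j) \<le> D * S ^ (i + j)"
    using assms(2) by (rule convergent_fps2E) blast
  show ?thesis
  proof (rule convergent_fps2I)
    fix i j
    have "norm ((F + G) $ i $ j) \<le> C * R ^ (i + j) + D * S ^ (i + j)"
      using norm_triangle_ineq[of "F $ i $ j" "G $ i $ j"] F[of i j] G[of i j] by simp
    also have "\<dots> \<le> C * max R S ^ (i + j) + D * max R S ^ (i + j)"
      by (intro add_mono mult_left_mono power_mono) (use C D in auto)
    finally show "norm ((F + G) $ i $ j) \<le> (C + D) * max R S ^ (i + j)"
      by (simp add: algebra_simps)
  qed (use C D in auto)
qed

lemma convergent_fps2_uminus: "convergent_fps2 F \<Longrightarrow> convergent_fps2 (- F)"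
  by (simp add: convergent_fps2_def)

lemma convergent_fps2_diff:
  "convergent_fps2 F \<Longrightarrow> convergent_fps2 G \<Longrightarrow> convergent_fps2 (F - G)"
  using convergent_fps2_add[of F "- G"] convergent_fps2_uminus[of G] by simp

lemma nat_le_two_power: "real (Suc n) \<le> 2 ^ n"
proof (induction n)
  case (Suc n)
  have "(1 :: real) \<le> 2 ^ n" by simp
  with Suc show ?case by (simp add: algebra_simps)
qed simp

lemma convergent_fps2_mult:
  assumes "convergent_fps2 F" "convergent_fps2 G"
  shows "convergent_fps2 (F * G)"
proof -
  obtain C R where C: "C \<ge> 0" "R \<ge> 1" and F: "\<And>i j. norm (F $ i $ j) \<le> C * R ^ (i + j)"
    using assms(1) by (rule convergent_fps2E) blast
  obtain D S where D: "D \<ge> 0" "S \<ge> 1" and G: "\<And>i j. norm (G $ i $ j) \<le> D * S ^ (i + j)"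
    using assms(2) by (rule convergent_fps2E) blast
  define M where "M = max R S"
  have M: "M \<ge> 1" "R \<le> M" "S \<le> M" using C by (auto simp: M_def)
  show ?thesis
  proof (rule convergent_fps2I)
    fix i j
    have term_le: "norm (F $ a $ b * G $ (i - a) $ (j - b)) \<le> C * D * M ^ (i + j)"
      if "a \<le> i" "b \<le> j" for a b
    proof -
      have "norm (F $ a $ b * G $ (i - a) $ (j - b)) \<le>
              (C * R ^ (a + b)) * (D * S ^ ((i - a) + (j - b)))"
        unfolding norm_mult by (intro mult_mono F G) (use C D in auto)
      also have "\<dots> \<le> (C * M ^ (a + b)) * (D * M ^ ((i - a) + (j - b)))"
        by (intro mult_mono mult_left_mono power_mono) (use C D M in auto)
      also have "\<dots> = C * D * M ^ ((a + b) + ((i - a) + (j - b)))"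
        by (simp add: power_add)
      also have "(a + b) + ((i - a) + (j - b)) = i + j" using that by simp
      finally show ?thesis .
    qed
    have "(F * G) $ i $ j = (\<Sum>a=0..i. \<Sum>b=0..j. F $ a $ b * G $ (i - a) $ (j - b))"
      by (simp add: fps_mult_nth fps_sum_nth)
    also have "norm \<dots> \<le> (\<Sum>a=0..i. \<Sum>b=0..j. C * D * M ^ (i + j))"
      by (intro sum_norm_le) (use term_le in auto)
    also have "\<dots> = (real (Suc i) * real (Suc j)) * (C * D * M ^ (i + j))"
      by (simp add: algebra_simps)
    also have "\<dots> \<le> (2 ^ i * 2 ^ j) * (C * D * M ^ (i + j))"
      by (intro mult_right_mono mult_mono nat_le_two_power) (use C D M in auto)
    also have "\<dots> = C * D * (2 * M) ^ (i + j)"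
      by (simp add: power_add power_mult_distrib)
    finally show "norm ((F * G) $ i $ j) \<le> C * D * (2 * M) ^ (i + j)" .
  qed (use C D M in auto)
qed

lemma convergent_fps2_of_poly: "convergent_fps2 (Abs_fps (\<lambda>i. fps_of_poly (coeff f i)))"
proof (rule convergent_fps2I)
  define C where "C = (\<Sum>i\<le>degree f. \<Sum>j\<le>degree (coeff f i). norm (coeff (coeff f i) j))"
  show "C \<ge> 0" by (auto simp: C_def intro!: sum_nonneg)
  fix i j
  show "norm (Abs_fps (\<lambda>i. fps_of_poly (coeff f i)) $ i $ j) \<le> C * 1 ^ (i + j)"
  proof (cases "i \<le> degree f \<and> j \<le> degree (coeff f i)")
    case True
    then have "norm (coeff (coeff f i) j) \<le> (\<Sum>j\<le>degree (coeff f i). norm (coeff (coeff f i) j))"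
      by (intro member_le_sum) auto
    also have "\<dots> \<le> C" unfolding C_def
      using True
      by (intro member_le_sum[where f = "\<lambda>i. \<Sum>j\<le>degree (coeff f i). norm (coeff (coeff f i) j)"])
         (auto intro!: sum_nonneg)
    finally show ?thesis by simp
  next
    case False
    then have "coeff (coeff f i) j = 0" by (metis coeff_0 le_degree)
    with \<open>C \<ge> 0\<close> show ?thesis by simp
  qed
qed simp

lemma convergent_fps2_const: "convergent_fps2 (fps_const (fps_const c))"
  by (rule convergent_fps2I[of "norm c" 1]) auto

lemma convergent_fps2_deriv_x:
  assumes "convergent_fps2 F"
  shows "convergent_fps2 (fps_deriv F)"
proof -
  obtain C R where C: "C \<ge> 0" "R \<ge> 1" and F: "\<And>i j. norm (F $ i $ j) \<le> C * R ^ (i + j)"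
    using assms by (rule convergent_fps2E) blast
  show ?thesis
  proof (rule convergent_fps2I)
    fix i j
    have "fps_deriv F $ i $ j = of_nat (Suc i) * F $ (Suc i) $ j"
      by (simp add: fps_of_nat[symmetric] algebra_simps del: fps_of_nat)
    then have "norm (fps_deriv F $ i $ j) = real (Suc i) * norm (F $ (Suc i) $ j)"
      by (simp only: norm_mult norm_of_nat)
    also have "\<dots> \<le> 2 ^ (i + j) * (C * R ^ (Suc i + j))"
      by (intro mult_mono F order.trans[OF nat_le_two_power] power_increasing) auto
    finally show "norm (fps_deriv F $ i $ j) \<le> (C * R) * (2 * R) ^ (i + j)"
      by (simp add: power_mult_distrib mult_ac)
  qed (use C in auto)
qed

lemma convergent_fps2_deriv_y:
  assumes "convergent_fps2 F"
  shows "convergent_fps2 (Abs_fps (\<lambda>i. fps_deriv (F $ i)))"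
proof -
  obtain C R where C: "C \<ge> 0" "R \<ge> 1" and F: "\<And>i j. norm (F $ i $ j) \<le> C * R ^ (i + j)"
    using assms by (rule convergent_fps2E) blast
  show ?thesis
  proof (rule convergent_fps2I)
    fix i j
    have "Abs_fps (\<lambda>i. fps_deriv (F $ i)) $ i $ j = of_nat (Suc j) * F $ i $ (Suc j)"
      by simp
    then have "norm (Abs_fps (\<lambda>i. fps_deriv (F $ i)) $ i $ j) = real (Suc j) * norm (F $ i $ (Suc j))"
      by (simp only: norm_mult norm_of_nat)
    also have "\<dots> \<le> 2 ^ (i + j) * (C * R ^ (i + Suc j))"
      by (intro mult_mono F order.trans[OF nat_le_two_power] power_increasing) auto
    finally show "norm (Abs_fps (\<lambda>i. fps_deriv (F $ i)) $ i $ j) \<le> (C * R) * (2 * R) ^ (i + j)"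
      by (simp add: power_mult_distrib mult_ac)
  qed (use C in auto)
qed

typedef germ2 = "{F :: complex fps fps. convergent_fps2 F}"
  morphisms fps_of_germ Germ
  using convergent_fps2_const by blast

setup_lifting type_definition_germ2

instantiation germ2 :: idom
begin

lift_definition zero_germ2 :: germ2 is 0
  using convergent_fps2_const[of 0] by simp

lift_definition one_germ2 :: germ2 is 1
  using convergent_fps2_const[of 1] by simp

lift_definition plus_germ2 :: "germ2 \<Rightarrow> germ2 \<Rightarrow> germ2" is "(+)"
  by (rule convergent_fps2_add)

lift_definition minus_germ2 :: "germ2 \<Rightarrow> germ2 \<Rightarrow> germ2" is "(-)"
  by (rule convergent_fps2_diff)

lift_definition uminus_germ2 :: "germ2 \<Rightarrow> germ2" is uminus
  by (rule convergent_fps2_uminus)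

lift_definition times_germ2 :: "germ2 \<Rightarrow> germ2 \<Rightarrow> germ2" is "(*)"
  by (rule convergent_fps2_mult)

instance
  by standard (transfer; simp add: algebra_simps)+

end

lift_definition germ_coeff :: "germ2 \<Rightarrow> nat \<Rightarrow> nat \<Rightarrow> complex" is "\<lambda>F i j. F $ i $ j" .

lift_definition germ_of_poly :: "complex poly poly \<Rightarrow> germ2"
  is "\<lambda>f. Abs_fps (\<lambda>i. fps_of_poly (coeff f i))"
  by (rule convergent_fps2_of_poly)

lift_definition germ_const :: "complex \<Rightarrow> germ2" is "\<lambda>c. fps_const (fps_const c)"
  by (rule convergent_fps2_const)

lift_definition germ_dx :: "germ2 \<Rightarrow> germ2" is fps_deriv
  by (rule convergent_fps2_deriv_x)

lift_definition germ_dy :: "germ2 \<Rightarrow> germ2" is "\<lambda>F. Abs_fps (\<lambda>i. fps_deriv (F $ i))"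
  by (rule convergent_fps2_deriv_y)

lemma germ2_eqI: "(\<And>i j. germ_coeff g i j = germ_coeff h i j) \<Longrightarrow> g = h"
  by transfer (auto simp: fps_eq_iff)

lemma germ_coeff_of_poly [simp]: "germ_coeff (germ_of_poly f) i j = coeff (coeff f i) j"
  by transfer simp

lemma germ_coeff_dx: "germ_coeff (germ_dx g) i j = of_nat (Suc i) * germ_coeff g (Suc i) j"
  by transfer (simp add: fps_of_nat[symmetric] algebra_simps del: fps_of_nat)

lemma germ_coeff_dy: "germ_coeff (germ_dy g) i j = of_nat (Suc j) * germ_coeff g i (Suc j)"
  by transfer simp

lemma germ_coeff_mult:
  "germ_coeff (g * h) i j = (\<Sum>a=0..i. \<Sum>b=0..j. germ_coeff g a b * germ_coeff h (i - a) (j - b))"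
  by transfer (simp add: fps_mult_nth fps_sum_nth)


section \<open>Ideals and dimensions of quotients\<close>

text \<open>An ideal of a ring is a submodule of the ring over itself.\<close>

lemma module_ring: "module ((*) :: 'a::comm_ring_1 \<Rightarrow> 'a \<Rightarrow> 'a)"
  by unfold_locales (simp_all add: algebra_simps)

definition ideal_gen :: "'a::comm_ring_1 set \<Rightarrow> 'a set" where
  "ideal_gen S = module.span (*) S"

definition ideal_mult :: "'a::comm_ring_1 set \<Rightarrow> 'a set \<Rightarrow> 'a set" where
  "ideal_mult I J = ideal_gen {a * b | a b. a \<in> I \<and> b \<in> J}"

primrec ideal_power :: "'a::comm_ring_1 set \<Rightarrow> nat \<Rightarrow> 'a set" where
  "ideal_power I 0 = UNIV"
| "ideal_power I (Suc k) = ideal_mult I (ideal_power I k)"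

definition ideal_add :: "'a::comm_ring_1 set \<Rightarrow> 'a set \<Rightarrow> 'a set" where
  "ideal_add I J = {a + b | a b. a \<in> I \<and> b \<in> J}"

definition germ_scale :: "complex \<Rightarrow> germ2 \<Rightarrow> germ2" where
  "germ_scale c g = germ_const c * g"

global_interpretation germ_vs: vector_space germ_scale
proof
  have add: "germ_const (a + b) = germ_const a + germ_const b"
    and mult: "germ_const (a * b) = germ_const a * germ_const b"
    and one: "germ_const 1 = 1" for a b
    by (transfer; simp)+
  fix a b g h
  show "germ_scale a (g + h) = germ_scale a g + germ_scale a h"
    and "germ_scale (a + b) g = germ_scale a g + germ_scale b g"
    and "germ_scale a (germ_scale b g) = germ_scale (a * b) g"
    and "germ_scale 1 g = g"
    by (simp_all add: germ_scale_def add mult one algebra_simps)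
qed

text \<open>
  A finite set \<open>B\<close> of representatives whose residue classes are pairwise distinct and form a basis
  of the complex vector space \<open>\<O>\<^sub>2/I\<close>: every class is a unique linear combination of them.
\<close>

definition quotient_basis :: "germ2 set \<Rightarrow> germ2 set \<Rightarrow> bool" where
  "quotient_basis I B \<longleftrightarrow> finite B \<and>
     (\<forall>g. \<exists>!c. (\<forall>b. b \<notin> B \<longrightarrow> c b = 0) \<and> g - (\<Sum>b\<in>B. germ_scale (c b) b) \<in> I)"

text \<open>
  For a subspace \<open>I\<close> this does not depend on the basis chosen, see \<open>quotient_dim_eq\<close> below; the
  dimension of an infinite-dimensional quotient is \<open>\<infinity>\<close>.
\<close>

definition quotient_dim :: "germ2 set \<Rightarrow> enat" where
  "quotient_dim I =
     (if \<exists>B. quotient_basis I B then enat (card (SOME B. quotient_basis I B)) else \<infinity>)"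

lemma quotient_basis_card_le:
  assumes I: "germ_vs.subspace I" and B: "quotient_basis I B" and D: "quotient_basis I D"
  shows "card D \<le> card B"
proof -
  define P where "P = (\<lambda>B g c. (\<forall>b. b \<notin> B \<longrightarrow> c b = 0) \<and>
    g - (\<Sum>b\<in>B. germ_scale (c b) b) \<in> I)"
  have finB: "finite B" and exB: "\<And>g. \<exists>c. P B g c"
    and finD: "finite D" and unD: "\<And>g c c'. P D g c \<Longrightarrow> P D g c' \<Longrightarrow> c = c'"
    using B D unfolding quotient_basis_def P_def by blast+
  define T where "T = (\<lambda>g. \<Sum>b\<in>B. germ_scale ((SOME c. P B g c) b) b)"
  have T: "g - T g \<in> I" for g
    using someI_ex[OF exB[of g]] by (auto simp: P_def T_def)
  have spanT: "T g \<in> germ_vs.span B" for g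
    unfolding T_def by (intro germ_vs.span_sum germ_vs.span_scale germ_vs.span_base)
  have indD: "c b = 0"
    if "(\<Sum>b\<in>D. germ_scale (c b) (T b)) = 0" and "b \<in> D" for c :: "germ2 \<Rightarrow> complex" and b
  proof -
    have "(\<Sum>b\<in>D. germ_scale (c b) (b - T b)) \<in> I"
      by (intro germ_vs.subspace_sum[OF I] germ_vs.subspace_scale[OF I] T)
    then have "(\<Sum>b\<in>D. germ_scale (c b) b) \<in> I"
      using that(1) by (simp add: germ_vs.scale_right_diff_distrib sum_subtractf)
    then have "- (\<Sum>b\<in>D. germ_scale (c b) b) \<in> I"
      by (rule germ_vs.subspace_neg[OF I])
    then have "P D 0 (\<lambda>b. if b \<in> D then c b else 0)"
      by (simp add: P_def cong: sum.cong)
    moreover have "P D 0 (\<lambda>_. 0)"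
      by (simp add: P_def germ_vs.subspace_0[OF I])
    ultimately have "(\<lambda>b. if b \<in> D then c b else 0) = (\<lambda>_. 0)" by (rule unD)
    from fun_cong[OF this, of b] that(2) show ?thesis by simp
  qed
  have inj: "inj_on T D"
  proof (rule inj_onI, rule ccontr)
    fix a b assume ab: "a \<in> D" "b \<in> D" "T a = T b" "a \<noteq> b"
    have "(\<Sum>d\<in>D. germ_scale ((\<lambda>d. if d = a then 1 else if d = b then -1 else 0) d) (T d)) =
        (\<Sum>d\<in>D. (if d = a then T d else 0) - (if d = b then T d else 0))"
      by (intro sum.cong) (use ab in auto)
    also have "\<dots> = 0" using ab finD by (simp add: sum_subtractf)
    finally show False using indD[of "\<lambda>d. if d = a then 1 else if d = b then -1 else 0" a] ab by simp
  qed
  have "germ_vs.independent (T ` D)"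
  proof (subst germ_vs.independent_explicit_finite_subsets, intro allI impI ballI)
    fix S :: "germ2 set" and u :: "germ2 \<Rightarrow> complex" and v
    assume S: "S \<subseteq> T ` D" "finite S" and z: "(\<Sum>v\<in>S. germ_scale (u v) v) = 0" and v: "v \<in> S"
    define c where "c = (\<lambda>d. if T d \<in> S then u (T d) else 0)"
    have "(\<Sum>d\<in>D. germ_scale (c d) (T d)) =
        (\<Sum>v\<in>T ` D. germ_scale (if v \<in> S then u v else 0) v)"
      by (simp add: sum.reindex[OF inj] c_def)
    also have "\<dots> = (\<Sum>v\<in>S. germ_scale (u v) v)"
      by (rule sum.mono_neutral_cong_right) (use S finD in auto)
    finally have "(\<Sum>d\<in>D. germ_scale (c d) (T d)) = 0" using z by simp
    moreover obtain d where "d \<in> D" "v = T d" using S v by blast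
    ultimately show "u v = 0" using indD[of c d] v by (simp add: c_def)
  qed
  then have "card (T ` D) \<le> card B"
    using germ_vs.independent_span_bound[OF finB, of "T ` D"] spanT by auto
  then show ?thesis by (simp add: card_image[OF inj])
qed

lemma quotient_dim_eq:
  assumes "germ_vs.subspace I" "quotient_basis I B"
  shows "quotient_dim I = enat (card B)"
proof -
  have "quotient_basis I (SOME B. quotient_basis I B)" using assms(2) by (rule someI)
  then have "card (SOME B. quotient_basis I B) = card B"
    using quotient_basis_card_le[OF assms(1)] assms(2) by (intro antisym) auto
  then show ?thesis using assms(2) by (auto simp: quotient_dim_def)
qed


section \<open>Plane curve germs\<close>

definition germ_max_ideal :: "germ2 set" where
  "germ_max_ideal = {g. germ_coeff g 0 0 = 0}"

definition multiplicity_at_0 :: "germ2 \<Rightarrow> nat" where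
  "multiplicity_at_0 f = (LEAST n. \<exists>i j. i + j = n \<and> germ_coeff f i j \<noteq> 0)"

definition singular_at_0 :: "germ2 \<Rightarrow> bool" where
  "singular_at_0 f \<longleftrightarrow> germ_coeff f 0 0 = 0 \<and> germ_coeff (germ_dx f) 0 0 = 0
     \<and> germ_coeff (germ_dy f) 0 0 = 0"

text \<open>The dimension of \<open>\<O>\<^sub>2/(\<mm>\<^sup>k\<langle>f\<^sub>x, f\<^sub>y\<rangle> + \<langle>f\<rangle>)\<close>.\<close>

definition tjurina_number :: "nat \<Rightarrow> germ2 \<Rightarrow> enat" where
  "tjurina_number k f = quotient_dim
     (ideal_add (ideal_mult (ideal_power germ_max_ideal k) (ideal_gen {germ_dx f, germ_dy f}))
                (ideal_gen {f}))"

definition weighted_homogeneous :: "rat \<Rightarrow> rat \<Rightarrow> complex poly poly \<Rightarrow> bool" where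
  "weighted_homogeneous w\<^sub>1 w\<^sub>2 f \<longleftrightarrow> w\<^sub>1 > 0 \<and> w\<^sub>2 > 0 \<and>
     (\<forall>i j. coeff (coeff f i) j \<noteq> 0 \<longrightarrow> w\<^sub>1 * of_nat i + w\<^sub>2 * of_nat j = 1)"

text \<open>
  The formula for the \<open>k\<close>-th Tjurina number of the Brieskorn curve \<open>x\<^bsup>a\<^esup> + y\<^bsup>b\<^esup> = 0\<close>, as a function
  of rational arguments \<open>a\<close>, \<open>b\<close>.
\<close>

definition brieskorn_tjurina :: "nat \<Rightarrow> rat \<Rightarrow> rat \<Rightarrow> rat" where
  "brieskorn_tjurina k a b =
     (if of_nat k < a
      then (a - 1) * (b - 1) + of_nat k * (of_nat k + 3) / 2
      else (a - 1) * (b - 1) + of_nat k * (of_nat k + 3) / 2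
           - (of_nat k - a + 2) * (of_nat k - a + 1) / 2)"

end

theory Submission
  imports Defs
begin

text \<open>
  Write \<open>f\<close> as homogeneous of degree \<open>N\<close> for integer weights \<open>u\<close>, \<open>v\<close>, and bound the codimension
  of the ideal from below modulo terms of weighted degree at least \<open>D\<close>. There the multiples of
  \<open>f\<^sub>x\<close> and of \<open>f\<^sub>y\<close> by elements of \<open>\<mm>\<^sup>k\<close> are counted by lattice points, their intersection
  contains the Koszul multiples of \<open>f\<^sub>x f\<^sub>y\<close>, and by Euler's relation \<open>f\<close> adds at most
  \<open>k (k - 1) / 2\<close> dimensions. What remains is a second difference of a lattice point count, whose
  average over \<open>D\<close> is the Milnor number \<open>(1/w\<^sub>1 - 1) (1/w\<^sub>2 - 1)\<close>; only one value of \<open>D\<close>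
  reaching this average is needed. As only an upper bound for the dimension of the ideal matters,
  no regular sequence property of \<open>f\<^sub>x, f\<^sub>y\<close> enters.
\<close>

section \<open>Counting lattice points under a weighted line\<close>

text \<open>For positive weights, these are the exponents of the monomials that form a basis of the
  germs modulo weighted degree at least \<open>D\<close>.\<close>

definition weighted_box :: "nat \<Rightarrow> nat \<Rightarrow> nat \<Rightarrow> (nat \<times> nat) set" where
  "weighted_box u v D = {(i, j). u * i + v * j < D}"

lemma mem_weighted_box [simp]: "(i, j) \<in> weighted_box u v D \<longleftrightarrow> u * i + v * j < D"
  by (simp add: weighted_box_def)

lemma finite_weighted_box [simp]:
  assumes "u > 0" "v > 0"
  shows "finite (weighted_box u v D)"
proof (rule finite_subset)
  show "weighted_box u v D \<subseteq> {..<D} \<times> {..<D}"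
  proof clarify
    fix i j assume "(i, j) \<in> weighted_box u v D"
    moreover have "1 * i \<le> u * i" "1 * j \<le> v * j"
      using assms by (intro mult_le_mono1; simp)+
    ultimately show "i \<in> {..<D} \<and> j \<in> {..<D}"
      unfolding mem_weighted_box lessThan_iff by linarith
  qed
qed simp

lemma card_multiples_shift:
  fixes v E :: nat
  assumes "v > 0"
  shows "card {j. v * j < E + v} = Suc (card {j. v * j < E})"
proof -
  have fin: "finite {j. v * j < E}"
    by (rule finite_subset[of _ "{..<E}"]) (use assms in \<open>auto intro: le_less_trans[rotated]\<close>)
  have "{j. v * j < E + v} = insert 0 (Suc ` {j. v * j < E})"
  proof (rule set_eqI)
    fix j show "j \<in> {j. v * j < E + v} \<longleftrightarrow> j \<in> insert 0 (Suc ` {j. v * j < E})"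
      using assms by (cases j) auto
  qed
  then show ?thesis using fin by (simp add: card_image)
qed

text \<open>The points with \<open>i > 0\<close> are the box of bound \<open>D\<close> moved by one
  in \<open>i\<close>; the column \<open>i = 0\<close> supplies the rest.\<close>

lemma card_weighted_box_shift:
  assumes "u > 0" "v > 0"
  shows "card (weighted_box u v (D + u)) = card (weighted_box u v D) + card {j. v * j < D + u}"
proof -
  have fin: "finite {j. v * j < D + u}"
    by (rule finite_subset[of _ "{..<D+u}"]) (use assms in \<open>auto intro: le_less_trans[rotated]\<close>)
  let ?s = "\<lambda>(i, j). (Suc i, j)"
  have "weighted_box u v (D + u) =
      ?s ` weighted_box u v D \<union> Pair 0 ` {j. v * j < D + u}"
  proof (rule set_eqI, clarify)
    fix i j
    show "(i, j) \<in> weighted_box u v (D + u) \<longleftrightarrow>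
        (i, j) \<in> ?s ` weighted_box u v D \<union> Pair 0 ` {j. v * j < D + u}"
      by (cases i) (auto simp: image_iff Bex_def)
  qed
  also have "card \<dots> = card (?s ` weighted_box u v D) + card (Pair (0 :: nat) ` {j. v * j < D + u})"
    by (rule card_Un_disjoint) (use assms fin in auto)
  also have "\<dots> = card (weighted_box u v D) + card {j. v * j < D + u}"
    by (subst card_image, force simp: inj_on_def)+ simp
  finally show ?thesis .
qed

text \<open>The counts have the generating function t / ((1 - t) (1 - t^u) (1 - t^v)); taking
  differences with steps \<open>u\<close> and \<open>v\<close> cancels the last two factors and
  leaves the constant 1.\<close>

lemma card_weighted_box_second_difference:
  assumes "u > 0" "v > 0"
  shows "card (weighted_box u v (D + u + v)) + card (weighted_box u v D) =
    card (weighted_box u v (D + u)) + card (weighted_box u v (D + v)) + 1"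
  using card_weighted_box_shift[OF assms, of D] card_weighted_box_shift[OF assms, of "D + v"]
    card_multiples_shift[OF assms(2), of "D + u"]
  by (simp add: add_ac)

lemma quadratic_of_second_difference:
  fixes Q :: "nat \<Rightarrow> rat"
  assumes "\<And>D. Q (D + 2) - 2 * Q (D + 1) + Q D = 1"
  shows "Q D = Q 0 + of_nat D * (Q 1 - Q 0) + of_nat D * (of_nat D - 1) / 2"
proof (induction D rule: less_induct)
  case (less D)
  consider "D = 0" | "D = 1" | n where "D = n + 2"
    by (metis One_nat_def add_2_eq_Suc' not0_implies_Suc)
  then show ?case
  proof cases
    case 3
    have "Q D = 2 * Q (n + 1) - Q n + 1" using assms[of n] 3 by (simp add: algebra_simps)
    also have "\<dots> = 2 * (Q 0 + of_nat (n + 1) * (Q 1 - Q 0) + of_nat (n + 1) * (of_nat (n + 1) - 1) / 2)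
        - (Q 0 + of_nat n * (Q 1 - Q 0) + of_nat n * (of_nat n - 1) / 2) + 1"
      using less.IH[of n] less.IH[of "n + 1"] 3 by simp
    finally show ?thesis using 3 by (simp add: field_simps)
  qed simp_all
qed

text \<open>
  The second difference of the lattice point count oscillates with \<open>E\<close>, but its average over
  \<open>E + s + t\<close> with \<open>s < u\<close> and \<open>t < v\<close> is exactly \<open>e\<^sub>1 e\<^sub>2 / (u v)\<close>.
\<close>

lemma weighted_box_second_difference_ge:
  fixes e1 e2 E0 :: nat
  assumes uv: "u > 0" "v > 0"
  obtains E where "E \<ge> E0" and
    "of_nat (card (weighted_box u v (E + e1 + e2))) - of_nat (card (weighted_box u v (E + e1)))
       - of_nat (card (weighted_box u v (E + e2))) + of_nat (card (weighted_box u v E))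
     \<ge> (of_nat e1 * of_nat e2 / (of_nat u * of_nat v) :: rat)"
proof -
  define n where "n D = (of_nat (card (weighted_box u v D)) :: rat)" for D
  \<comment> \<open>Summing over a full \<open>u\<close> by \<open>v\<close> block makes unit steps
    telescope to steps of length \<open>u\<close> and \<open>v\<close>, so \<open>Q\<close> has
    second difference exactly 1 and is a quadratic polynomial.\<close>
  define Q where "Q D = (\<Sum>s<u. \<Sum>t<v. n (D + s + t))" for D
  have n2: "n (D + u + v) - n (D + u) - n (D + v) + n D = 1" for D
    using arg_cong[OF card_weighted_box_second_difference[OF uv, of D], of "of_nat :: nat \<Rightarrow> rat"]
    by (simp add: n_def)
  have tele: "(\<Sum>t<m. F (t + 1) - F t) = F m - F 0" for F :: "nat \<Rightarrow> rat" and m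
    using sum_lessThan_telescope[of F m] by simp
  have "Q (D + 2) - 2 * Q (D + 1) + Q D = 1" for D
  proof -
    have "Q (D + 2) - 2 * Q (D + 1) + Q D =
        (\<Sum>s<u. \<Sum>t<v. (n (D + 1 + s + (t + 1)) - n (D + 1 + s + t)) -
                      (n (D + s + (t + 1)) - n (D + s + t)))"
      by (simp add: Q_def sum.distrib sum_subtractf sum_distrib_left add_ac)
    also have "\<dots> = (\<Sum>s<u. (n (D + (s + 1) + v) - n (D + (s + 1))) - (n (D + s + v) - n (D + s)))"
    proof (rule sum.cong[OF refl])
      fix s
      show "(\<Sum>t<v. (n (D + 1 + s + (t + 1)) - n (D + 1 + s + t)) -
              (n (D + s + (t + 1)) - n (D + s + t)))
        = (n (D + (s + 1) + v) - n (D + (s + 1))) - (n (D + s + v) - n (D + s))"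
        using tele[of "\<lambda>t. n (D + 1 + s + t) - n (D + s + t)" v]
        by (simp add: algebra_simps)
    qed
    also have "\<dots> = 1"
      using tele[of "\<lambda>s. n (D + s + v) - n (D + s)" u] n2[of D] by (simp add: algebra_simps)
    finally show ?thesis .
  qed
  note Q = quadratic_of_second_difference[of Q, OF this]
  define d where "d E = n (E + e1 + e2) - n (E + e1) - n (E + e2) + n E" for E
  have "(\<Sum>s<u. \<Sum>t<v. d (E0 + s + t)) = Q (E0 + e1 + e2) - Q (E0 + e1) - Q (E0 + e2) + Q E0"
    by (simp add: Q_def d_def sum.distrib sum_subtractf add_ac)
  \<comment> \<open>In the mixed difference with steps \<open>e1\<close> and \<open>e2\<close>, the
    constant and linear terms of \<open>Q\<close> cancel, and the leading coefficient 1/2 yields the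
    product.\<close>
  also have "\<dots> = of_nat e1 * of_nat e2"
    by (subst (1 2 3 4) Q) (simp add: field_simps)
  finally have sum: "(\<Sum>s<u. \<Sum>t<v. d (E0 + s + t)) = of_nat e1 * of_nat e2" .
  \<comment> \<open>Some one of the \<open>u * v\<close> summands reaches their average.\<close>
  have "\<exists>s<u. \<exists>t<v. d (E0 + s + t) \<ge> of_nat e1 * of_nat e2 / (of_nat u * of_nat v)"
  proof (rule ccontr)
    assume "\<not> ?thesis"
    then have "(\<Sum>s<u. \<Sum>t<v. d (E0 + s + t)) <
        (\<Sum>s<u. \<Sum>t<v. of_nat e1 * of_nat e2 / (of_nat u * of_nat v))"
      by (intro sum_strict_mono) (use uv in \<open>auto simp: not_le\<close>)
    also have "\<dots> = of_nat e1 * of_nat e2" using uv by simp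
    finally show False using sum by simp
  qed
  then obtain s t where "d (E0 + s + t) \<ge> of_nat e1 * of_nat e2 / (of_nat u * of_nat v)" by blast
  then show thesis by (intro that[of "E0 + s + t"]) (simp_all add: d_def n_def)
qed

section \<open>Removing the monomials of low order from a weighted box\<close>

lemma card_triangle: "2 * card {(i, j). i + j < (n :: nat)} = n * (n + 1)"
proof (induction n)
  case (Suc n)
  have fin: "finite {(i, j). i + j < n}"
    by (rule finite_subset[of _ "{..<n} \<times> {..<n}"]) auto
  have "{(i, j). i + j < Suc n} = {(i, j). i + j < n} \<union> (\<lambda>i. (i, n - i)) ` {..n}"
    by (auto simp: image_iff)
  also have "card \<dots> = card {(i, j). i + j < n} + card ((\<lambda>i. (i, n - i)) ` {..n})"
    by (rule card_Un_disjoint) (use fin in auto)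
  also have "card ((\<lambda>i. (i, n - i)) ` {..n}) = n + 1"
    by (subst card_image) (auto simp: inj_on_def)
  finally show ?case using Suc by simp
qed simp

lemma finite_triangle [simp]: "finite {(i, j). i + j < (n :: nat)}"
  by (rule finite_subset[of _ "{..<n} \<times> {..<n}"]) auto

text \<open>The bound on \<open>D\<close> places the whole triangle \<open>i + j < m\<close> inside
  the box, so removing it costs exactly m (m + 1) / 2 points. The doubled additive form avoids
  division and subtraction of natural numbers.\<close>

lemma card_weighted_box_above_diagonal:
  assumes uv: "u > 0" "v > 0" and D: "(u + v) * m \<le> D"
  shows "2 * card {(i, j) \<in> weighted_box u v D. m \<le> i + j} + m * (m + 1) =
    2 * card (weighted_box u v D)"
proof -
  have sub: "{(i, j). i + j < m} \<subseteq> weighted_box u v D"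
  proof clarify
    fix i j assume "i + j < m"
    then have "(u + v) * (i + j) < (u + v) * m" using uv by (intro mult_strict_left_mono) auto
    moreover have "u * i + v * j \<le> (u + v) * (i + j)" by (simp add: algebra_simps)
    ultimately show "(i, j) \<in> weighted_box u v D"
      unfolding mem_weighted_box using D by linarith
  qed
  have "weighted_box u v D = {(i, j) \<in> weighted_box u v D. m \<le> i + j} \<union> {(i, j). i + j < m}"
    using sub by auto
  then have "card (weighted_box u v D) =
      card ({(i, j) \<in> weighted_box u v D. m \<le> i + j} \<union> {(i, j). i + j < m})"
    by (rule arg_cong)
  also have "\<dots> = card {(i, j) \<in> weighted_box u v D. m \<le> i + j} + card {(i, j). i + j < m}"
    by (rule card_Un_disjoint)
       (use uv in \<open>auto intro: finite_subset[OF _ finite_weighted_box[OF uv, of D]]\<close>)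
  finally show ?thesis using card_triangle[of m] by simp
qed


section \<open>Monomials, order filtration and weighted truncation\<close>

lemma germ_coeff_0 [simp]: "germ_coeff 0 i j = 0"
  by transfer simp

lemma germ_coeff_1: "germ_coeff 1 i j = (if i = 0 \<and> j = 0 then 1 else 0)"
  by transfer simp

lemma germ_coeff_add [simp]: "germ_coeff (g + h) i j = germ_coeff g i j + germ_coeff h i j"
  by transfer simp

lemma germ_coeff_scale [simp]: "germ_coeff (germ_scale c g) i j = c * germ_coeff g i j"
  unfolding germ_scale_def by transfer simp

lemma germ_coeff_sum [simp]: "germ_coeff (sum F A) i j = (\<Sum>a\<in>A. germ_coeff (F a) i j)"
  by (induction A rule: infinite_finite_induct) simp_all

lemma germ_scale_mult_left: "germ_scale c g * h = germ_scale c (g * h)"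
  and germ_scale_mult_right: "g * germ_scale c h = germ_scale c (g * h)"
  by (simp_all add: germ_scale_def mult_ac)

definition germ_monom :: "nat \<Rightarrow> nat \<Rightarrow> germ2" where
  "germ_monom i j = germ_of_poly (monom (monom 1 j) i)"

lemma germ_coeff_monom [simp]:
  "germ_coeff (germ_monom i j) a b = (if a = i \<and> b = j then 1 else 0)"
  by (auto simp: germ_monom_def)

lemma germ_monom_eq_iff [simp]: "germ_monom i j = germ_monom a b \<longleftrightarrow> i = a \<and> j = b"
  by (metis germ_coeff_monom zero_neq_one)

lemma germ_coeff_monom_mult:
  "germ_coeff (germ_monom i j * g) a b =
     (if i \<le> a \<and> j \<le> b then germ_coeff g (a - i) (b - j) else 0)"
proof -
  have "germ_coeff (germ_monom i j * g) a b =
      (\<Sum>c=0..a. \<Sum>d=0..b. if c = i then if d = j then germ_coeff g (a - c) (b - d) else 0 else 0)"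
    unfolding germ_coeff_mult by (intro sum.cong refl) simp
  also have "\<dots> = (\<Sum>c=0..a. if c = i then (\<Sum>d=0..b. if d = j then germ_coeff g (a - c) (b - d) else 0) else 0)"
    by (intro sum.cong refl) simp
  finally show ?thesis by (simp add: sum.delta')
qed

lemma germ_monom_mult: "germ_monom i j * germ_monom a b = germ_monom (i + a) (j + b)"
  by (rule germ2_eqI) (auto simp: germ_coeff_monom_mult)

text \<open>This bounds the \<open>k\<close>-th power of the maximal ideal from above in a form that
  is read off from coefficients.\<close>

definition order_ge :: "nat \<Rightarrow> germ2 set" where
  "order_ge k = {g. \<forall>i j. i + j < k \<longrightarrow> germ_coeff g i j = 0}"

lemma order_ge_mult:
  assumes "g \<in> order_ge a" "h \<in> order_ge b"
  shows "g * h \<in> order_ge (a + b)"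
  unfolding order_ge_def
proof (intro CollectI allI impI)
  fix i j assume ij: "i + j < a + b"
  have "germ_coeff g c d * germ_coeff h (i - c) (j - d) = 0" if "c \<le> i" "d \<le> j" for c d
  proof (cases "c + d < a")
    case False
    then have "(i - c) + (j - d) < b" using ij that by linarith
    then show ?thesis using assms(2) by (simp add: order_ge_def)
  qed (use assms(1) in \<open>simp add: order_ge_def\<close>)
  then show "germ_coeff (g * h) i j = 0"
    unfolding germ_coeff_mult by (intro sum.neutral ballI) simp
qed

lemma order_ge_0 [simp]: "g \<in> order_ge 0"
  by (simp add: order_ge_def)

lemma order_ge_mult_left: "h \<in> order_ge b \<Longrightarrow> g * h \<in> order_ge b"
  using order_ge_mult[of g 0 h b] by simp

lemma order_ge_add: "g \<in> order_ge a \<Longrightarrow> h \<in> order_ge a \<Longrightarrow> g + h \<in> order_ge a"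
  and order_ge_zero: "0 \<in> order_ge a"
  by (simp_all add: order_ge_def)

lemma order_ge_monom: "k \<le> i + j \<Longrightarrow> germ_monom i j \<in> order_ge k"
  by (auto simp: order_ge_def)

section \<open>The shape of the elements of the Tjurina ideal\<close>

lemma ideal_gen_subset:
  assumes "S \<subseteq> T" "0 \<in> T" "\<And>x y. x \<in> T \<Longrightarrow> y \<in> T \<Longrightarrow> x + y \<in> T" "\<And>c x. x \<in> T \<Longrightarrow> c * x \<in> T"
  shows "ideal_gen S \<subseteq> T"
  unfolding ideal_gen_def using assms
  by (intro module.span_minimal[OF module_ring]) (auto simp: module.subspace_def[OF module_ring])

lemma ideal_power_max_ideal_subset: "ideal_power germ_max_ideal k \<subseteq> order_ge k"
proof (induction k)
  case (Suc k)
  have "germ_max_ideal \<subseteq> order_ge 1" by (auto simp: germ_max_ideal_def order_ge_def)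
  then have "a * b \<in> order_ge (Suc k)" if "a \<in> germ_max_ideal" "b \<in> ideal_power germ_max_ideal k"
    for a b using order_ge_mult[of a 1 b k] that Suc by auto
  then show ?case unfolding ideal_power.simps ideal_mult_def
    by (intro ideal_gen_subset) (auto intro: order_ge_add order_ge_zero order_ge_mult_left)
qed auto

text \<open>An inclusion serves a lower bound for the codimension: allowing all coefficients
  \<open>a\<close>, \<open>b\<close> of order at least \<open>k\<close> can only shrink the
  quotient.\<close>

lemma tjurina_ideal_subset:
  "ideal_add (ideal_mult (ideal_power germ_max_ideal k) (ideal_gen {p, q})) (ideal_gen {f})
     \<subseteq> {a * p + b * q + h * f | a b h. a \<in> order_ge k \<and> b \<in> order_ge k}"
proof -
  have pq: "ideal_gen {p, q} \<subseteq> {a * p + b * q | a b. True}"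
  proof (rule ideal_gen_subset)
    show "{p, q} \<subseteq> {a * p + b * q | a b. True}"
    proof -
      have "p = 1 * p + 0 * q" "q = 0 * p + 1 * q" by simp_all
      then show ?thesis by blast
    qed
    have "0 = 0 * p + 0 * q" by simp
    then show "0 \<in> {a * p + b * q | a b. True}" by blast
  next
    fix x y assume "x \<in> {a * p + b * q | a b. True}" "y \<in> {a * p + b * q | a b. True}"
    then obtain a b c d where "x = a * p + b * q" "y = c * p + d * q" by blast
    then have "x + y = (a + c) * p + (b + d) * q" by (simp add: algebra_simps)
    then show "x + y \<in> {a * p + b * q | a b. True}" by blast
  next
    fix c x assume "x \<in> {a * p + b * q | a b. True}"
    then obtain a b where "x = a * p + b * q" by blast
    then have "c * x = (c * a) * p + (c * b) * q" by (simp add: algebra_simps)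
    then show "c * x \<in> {a * p + b * q | a b. True}" by blast
  qed
  let ?T = "{a * p + b * q | a b. a \<in> order_ge k \<and> b \<in> order_ge k}"
  have mult: "ideal_mult (ideal_power germ_max_ideal k) (ideal_gen {p, q}) \<subseteq> ?T"
    unfolding ideal_mult_def
  proof (rule ideal_gen_subset)
    show "{a * b | a b. a \<in> ideal_power germ_max_ideal k \<and> b \<in> ideal_gen {p, q}} \<subseteq> ?T"
    proof clarify
      fix c x assume c: "c \<in> ideal_power germ_max_ideal k" and "x \<in> ideal_gen {p, q}"
      then obtain a b where "x = a * p + b * q" using pq by blast
      then have "c * x = (a * c) * p + (b * c) * q" by (simp add: algebra_simps)
      moreover have "c \<in> order_ge k" using c ideal_power_max_ideal_subset by blast
      ultimately show "\<exists>a b. c * x = a * p + b * q \<and> a \<in> order_ge k \<and> b \<in> order_ge k"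
        using order_ge_mult_left by blast
    qed
    have "0 = 0 * p + 0 * q" by simp
    then show "0 \<in> ?T" using order_ge_zero by blast
  next
    fix x y assume "x \<in> ?T" "y \<in> ?T"
    then obtain a b c d where "x = a * p + b * q" "y = c * p + d * q"
      and o: "a \<in> order_ge k" "b \<in> order_ge k" "c \<in> order_ge k" "d \<in> order_ge k" by blast
    then have "x + y = (a + c) * p + (b + d) * q" by (simp add: algebra_simps)
    then show "x + y \<in> ?T" using o order_ge_add by blast
  next
    fix c x assume "x \<in> ?T"
    then obtain a b where "x = a * p + b * q" and o: "a \<in> order_ge k" "b \<in> order_ge k" by blast
    then have "c * x = (c * a) * p + (c * b) * q" by (simp add: algebra_simps)
    then show "c * x \<in> ?T" using o order_ge_mult_left by blast
  qed
  have gen: "ideal_gen {f} \<subseteq> {h * f | h. True}"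
  proof (rule ideal_gen_subset)
    show "{f} \<subseteq> {h * f | h. True}" by (auto intro!: exI[of _ 1])
    show "0 \<in> {h * f | h. True}" by (auto intro!: exI[of _ 0])
  next
    fix x y assume "x \<in> {h * f | h. True}" "y \<in> {h * f | h. True}"
    then obtain a b where "x = a * f" "y = b * f" by blast
    then have "x + y = (a + b) * f" by (simp add: algebra_simps)
    then show "x + y \<in> {h * f | h. True}" by blast
  next
    fix c x assume "x \<in> {h * f | h. True}"
    then obtain a where "x = a * f" by blast
    then have "c * x = (c * a) * f" by (simp add: algebra_simps)
    then show "c * x \<in> {h * f | h. True}" by blast
  qed
  show ?thesis using mult gen unfolding ideal_add_def by blast
qed

text \<open>For positive weights, this is the linear projection onto the span of the monomials in
  the box, with kernel the germs of weighted degree at least \<open>D\<close>. It moves the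
  dimension count into a finite-dimensional space.\<close>

definition germ_truncate :: "nat \<Rightarrow> nat \<Rightarrow> nat \<Rightarrow> germ2 \<Rightarrow> germ2" where
  "germ_truncate u v D g =
     (\<Sum>(i, j)\<in>weighted_box u v D. germ_scale (germ_coeff g i j) (germ_monom i j))"

lemma germ_coeff_sum_monom:
  assumes "finite S"
  shows "germ_coeff (\<Sum>(i, j)\<in>S. germ_scale (c (i, j)) (germ_monom i j)) a b =
    (if (a, b) \<in> S then c (a, b) else 0)"
proof -
  have "germ_coeff (\<Sum>(i, j)\<in>S. germ_scale (c (i, j)) (germ_monom i j)) a b =
      (\<Sum>p\<in>S. if p = (a, b) then c p else 0)"
    by (simp add: case_prod_beta, intro sum.cong refl) auto
  then show ?thesis using assms by (simp add: sum.delta')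
qed

lemma germ_coeff_truncate:
  assumes "u > 0" "v > 0"
  shows "germ_coeff (germ_truncate u v D g) a b = (if u * a + v * b < D then germ_coeff g a b else 0)"
  using germ_coeff_sum_monom[OF finite_weighted_box[OF assms, of D],
      of "\<lambda>(i, j). germ_coeff g i j" a b]
  by (simp add: germ_truncate_def)

lemma germ_truncate_monom:
  assumes "u > 0" "v > 0" "u * i + v * j < D"
  shows "germ_truncate u v D (germ_monom i j) = germ_monom i j"
  by (rule germ2_eqI) (use assms in \<open>auto simp: germ_coeff_truncate\<close>)

lemma germ_truncate_add:
  "germ_truncate u v D (g + h) = germ_truncate u v D g + germ_truncate u v D h"
  by (simp add: germ_truncate_def case_prod_beta germ_vs.scale_left_distrib sum.distrib)

lemma germ_truncate_scale:
  "germ_truncate u v D (germ_scale c g) = germ_scale c (germ_truncate u v D g)"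
  by (simp add: germ_truncate_def case_prod_beta germ_vs.scale_sum_right)

lemma germ_truncate_sum:
  "germ_truncate u v D (sum F A) = (\<Sum>a\<in>A. germ_truncate u v D (F a))"
  by (induction A rule: infinite_finite_induct)
     (simp_all add: germ_truncate_add, simp_all add: germ_truncate_def case_prod_beta)

text \<open>The zero germ is homogeneous of every degree, so nonvanishing is stated separately where
  it matters.\<close>

definition germ_homogeneous :: "nat \<Rightarrow> nat \<Rightarrow> nat \<Rightarrow> germ2 \<Rightarrow> bool" where
  "germ_homogeneous u v e p \<longleftrightarrow> (\<forall>i j. germ_coeff p i j \<noteq> 0 \<longrightarrow> u * i + v * j = e)"

text \<open>Multiplication by \<open>p\<close> raises every weighted degree by exactly
  \<open>e\<close>, so it shifts the truncation bound by \<open>e\<close>.\<close>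

lemma germ_truncate_homogeneous_mult:
  assumes uv: "u > 0" "v > 0" and p: "germ_homogeneous u v e p"
  shows "germ_truncate u v (E + e) (p * g) = p * germ_truncate u v E g"
proof (rule germ2_eqI)
  fix a b
  have "germ_coeff (germ_truncate u v (E + e) (p * g)) a b =
      (\<Sum>c=0..a. \<Sum>d=0..b. if u * a + v * b < E + e
         then germ_coeff p c d * germ_coeff g (a - c) (b - d) else 0)"
    using uv by (simp add: germ_coeff_truncate germ_coeff_mult)
  also have "\<dots> = (\<Sum>c=0..a. \<Sum>d=0..b. germ_coeff p c d * germ_coeff (germ_truncate u v E g) (a - c) (b - d))"
  proof (intro sum.cong refl)
    fix c d assume cd: "c \<in> {0..a}" "d \<in> {0..b}"
    show "(if u * a + v * b < E + e then germ_coeff p c d * germ_coeff g (a - c) (b - d) else 0)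
      = germ_coeff p c d * germ_coeff (germ_truncate u v E g) (a - c) (b - d)"
    proof (cases "germ_coeff p c d = 0")
      case False
      then have e: "u * c + v * d = e" using p by (simp add: germ_homogeneous_def)
      obtain a' b' where ab: "a = c + a'" "b = d + b'"
        using cd by (auto simp: le_iff_add)
      have "u * a + v * b < E + e \<longleftrightarrow> u * a' + v * b' < E"
        unfolding ab using e by (auto simp: algebra_simps)
      then show ?thesis by (simp add: germ_coeff_truncate[OF uv] ab)
    qed simp
  qed
  finally show "germ_coeff (germ_truncate u v (E + e) (p * g)) a b =
      germ_coeff (p * germ_truncate u v E g) a b"
    by (simp only: germ_coeff_mult)
qed

section \<open>Dimensions of spans of monomial multiples\<close>

lemma independent_monom_multiples:
  assumes p: "p \<noteq> 0" and S: "finite S"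
  shows "germ_vs.independent ((\<lambda>(i, j). p * germ_monom i j) ` S)"
    and "card ((\<lambda>(i, j). p * germ_monom i j) ` S) = card S"
proof -
  have inj: "inj_on (\<lambda>(i, j). p * germ_monom i j) S"
    using p by (auto simp: inj_on_def)
  then show "card ((\<lambda>(i, j). p * germ_monom i j) ` S) = card S" by (rule card_image)
  show "germ_vs.independent ((\<lambda>(i, j). p * germ_monom i j) ` S)"
  proof (rule germ_vs.independent_if_scalars_zero)
    fix c x
    assume z: "(\<Sum>x\<in>(\<lambda>(i, j). p * germ_monom i j) ` S. germ_scale (c x) x) = 0"
      and x: "x \<in> (\<lambda>(i, j). p * germ_monom i j) ` S"
    define d where "d = (\<lambda>(i, j). c (p * germ_monom i j))"
    \<comment> \<open>Germs form an integral domain, so \<open>p\<close> can be cancelled from the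
      relation, which leaves one between distinct monomials.\<close>
    have "0 = (\<Sum>(i, j)\<in>S. germ_scale (d (i, j)) (p * germ_monom i j))"
      using z unfolding sum.reindex[OF inj] by (simp add: d_def o_def case_prod_beta)
    also have "\<dots> = p * (\<Sum>(i, j)\<in>S. germ_scale (d (i, j)) (germ_monom i j))"
      by (simp add: sum_distrib_left germ_scale_mult_right case_prod_beta)
    finally have "(\<Sum>(i, j)\<in>S. germ_scale (d (i, j)) (germ_monom i j)) = 0"
      using p by simp
    then have "(if (a, b) \<in> S then d (a, b) else 0) = 0" for a b
      using germ_coeff_sum_monom[OF S, of d a b] by simp
    then have "d (a, b) = 0" if "(a, b) \<in> S" for a b using that by presburger
    then show "c x = 0" using x by (auto simp: d_def)
  qed (use S in simp)
qed

text \<open>This is the dimension formula for a sum of two subspaces, with \<open>C\<close> bounding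
  the intersection from below. Extending \<open>C\<close> to bases of both spans makes it part of
  both, so it is counted once in their union.\<close>

lemma span_union_of_common_independent:
  assumes "finite A" "finite B" and C: "germ_vs.independent C"
    "C \<subseteq> germ_vs.span A" "C \<subseteq> germ_vs.span B"
  obtains S where "finite S" "card S + card C \<le> card A + card B"
    "germ_vs.span A \<subseteq> germ_vs.span S" "germ_vs.span B \<subseteq> germ_vs.span S"
proof -
  obtain A' where A': "C \<subseteq> A'" "A' \<subseteq> germ_vs.span A" "germ_vs.independent A'"
      "germ_vs.span A \<subseteq> germ_vs.span A'"
    using germ_vs.maximal_independent_subset_extend[OF C(2,1)] by blast
  obtain B' where B': "C \<subseteq> B'" "B' \<subseteq> germ_vs.span B" "germ_vs.independent B'"
      "germ_vs.span B \<subseteq> germ_vs.span B'"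
    using germ_vs.maximal_independent_subset_extend[OF C(3,1)] by blast
  have cA: "finite A'" "card A' \<le> card A"
    using germ_vs.independent_span_bound[OF assms(1) A'(3,2)] by auto
  have cB: "finite B'" "card B' \<le> card B"
    using germ_vs.independent_span_bound[OF assms(2) B'(3,2)] by auto
  have "card C \<le> card (A' \<inter> B')" using A' B' cA by (intro card_mono) auto
  then have "card (A' \<union> B') + card C \<le> card A + card B"
    using card_Un_Int[OF cA(1) cB(1)] cA cB by linarith
  moreover have "germ_vs.span A \<subseteq> germ_vs.span (A' \<union> B')" "germ_vs.span B \<subseteq> germ_vs.span (A' \<union> B')"
    using A'(4) B'(4) germ_vs.span_mono[of A' "A' \<union> B'"] germ_vs.span_mono[of B' "A' \<union> B'"] by auto
  ultimately show thesis using that cA cB by blast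
qed

text \<open>Coefficients of \<open>a\<close> of order below \<open>k\<close> vanish, so only
  monomials of order at least \<open>k\<close> contribute to the product.\<close>

lemma mult_truncate_in_span:
  assumes a: "a \<in> order_ge k"
  shows "p * germ_truncate u v E a \<in>
    germ_vs.span ((\<lambda>(i, j). p * germ_monom i j) ` {(i, j) \<in> weighted_box u v E. k \<le> i + j})"
    (is "_ \<in> germ_vs.span ?S")
proof -
  have "germ_scale (germ_coeff a i j) (p * germ_monom i j) \<in> germ_vs.span ?S"
    if "(i, j) \<in> weighted_box u v E" for i j
  proof (cases "k \<le> i + j")
    case True
    with that have "p * germ_monom i j \<in> ?S" by force
    then show ?thesis by (intro germ_vs.span_scale germ_vs.span_base)
  next
    case False
    then have "germ_coeff a i j = 0" using a by (simp add: order_ge_def)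
    then show ?thesis by (simp add: germ_vs.span_zero)
  qed
  then have "(\<Sum>(i, j)\<in>weighted_box u v E. germ_scale (germ_coeff a i j) (p * germ_monom i j))
      \<in> germ_vs.span ?S"
    by (intro germ_vs.span_sum) (auto simp: split_beta)
  also have "(\<Sum>(i, j)\<in>weighted_box u v E. germ_scale (germ_coeff a i j) (p * germ_monom i j)) =
      p * germ_truncate u v E a"
    by (simp add: germ_truncate_def sum_distrib_left germ_scale_mult_right case_prod_beta)
  finally show ?thesis .
qed


section \<open>The dimension count\<close>

text \<open>After truncation at \<open>E + e1 + e2\<close>, the image of \<open>I\<close> lies in a
  space of dimension at most the number of multiples of \<open>p\<close> and of \<open>q\<close>,
  less the multiples of \<open>p * q\<close> common to both, plus the multiples of \<open>f\<close>
  that these do not absorb. Together with the truncated elements of \<open>B\<close> that space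
  spans the whole box. The terms are arranged so that nothing is subtracted.\<close>

lemma quotient_basis_card_ge:
  fixes p q f x y :: germ2 and k \<mu> E e1 e2 :: nat
  assumes uv: "u > 0" "v > 0"
    and p: "germ_homogeneous u v e1 p" "p \<noteq> 0" "p \<in> order_ge \<mu>"
    and q: "germ_homogeneous u v e2 q" "q \<noteq> 0" "q \<in> order_ge \<mu>"
    and f: "f = x * p + y * q" "x \<in> order_ge 1" "y \<in> order_ge 1"
    and I: "I \<subseteq> {a * p + b * q + h * f | a b h. a \<in> order_ge k \<and> b \<in> order_ge k}"
    and B: "quotient_basis I B"
  shows "card (weighted_box u v (E + e1 + e2)) + card {(i, j) \<in> weighted_box u v E. k - \<mu> \<le> i + j}
    \<le> card B + card {(i, j) \<in> weighted_box u v (E + e2). k \<le> i + j}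
       + card {(i, j) \<in> weighted_box u v (E + e1). k \<le> i + j} + card {(i, j). i + j < k - 1}"
proof -
  define D where "D = E + e1 + e2"
  \<comment> \<open>Since \<open>p\<close> has degree \<open>e1\<close>, a multiple of
    \<open>p\<close> by a monomial survives truncation at \<open>D\<close> exactly when the monomial
    has weighted degree below \<open>E + e2\<close>; likewise for \<open>q\<close> and
    \<open>E + e1\<close>.\<close>
  define MA where "MA = {(i, j) \<in> weighted_box u v (E + e2). k \<le> i + j}"
  define MB where "MB = {(i, j) \<in> weighted_box u v (E + e1). k \<le> i + j}"
  \<comment> \<open>Both \<open>p\<close> and \<open>q\<close> have order at least
    \<open>\<mu>\<close>, so order \<open>k - \<mu>\<close> of a monomial already gives order
    \<open>k\<close> after multiplication by one of them. For \<open>\<mu> > k\<close> the truncated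
    difference imposes no condition.\<close>
  define MC where "MC = {(i, j) \<in> weighted_box u v E. k - \<mu> \<le> i + j}"
  \<comment> \<open>A multiplier of \<open>f\<close> of order at least \<open>k - 1\<close> is
    absorbed by \<open>p\<close> and \<open>q\<close>, because \<open>x\<close> and \<open>y\<close>
    add one to the order. For \<open>k = 0\<close> the set is empty.\<close>
  define MF where "MF = {(i, j). i + j < k - 1}"
  have fin: "finite MA" "finite MB" "finite MC" "finite MF" "finite B"
    using uv B by (auto simp: MA_def MB_def MC_def MF_def quotient_basis_def
        intro: finite_subset[OF _ finite_weighted_box[OF uv]])
  define SA where "SA = (\<lambda>(i, j). p * germ_monom i j) ` MA"
  define SB where "SB = (\<lambda>(i, j). q * germ_monom i j) ` MB"
  define SC where "SC = (\<lambda>(i, j). (p * q) * germ_monom i j) ` MC"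
  define SF where "SF = (\<lambda>(i, j). germ_truncate u v D (germ_monom i j * f)) ` MF"

  have C_indep: "germ_vs.independent SC" and card_C: "card SC = card MC"
    unfolding SC_def using independent_monom_multiples[of "p * q" MC] p(2) q(2) fin by auto
  \<comment> \<open>Stated for general \<open>g\<close> and \<open>h\<close> to be used twice: a
    monomial multiple of \<open>p * q\<close> is a multiple of \<open>p\<close> with a coefficient
    divisible by \<open>q\<close>, and vice versa.\<close>
  have koszul: "g * h * germ_monom i j \<in> germ_vs.span
      ((\<lambda>(i, j). g * germ_monom i j) ` {(i, j) \<in> weighted_box u v (E + e). k \<le> i + j})"
    if h: "germ_homogeneous u v e h" "h \<in> order_ge \<mu>" and ij: "(i, j) \<in> MC" for g h e i j
  proof -
    have "h * germ_monom i j \<in> order_ge (\<mu> + (k - \<mu>))"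
      using ij by (intro order_ge_mult h order_ge_monom) (auto simp: MC_def)
    then have "h * germ_monom i j \<in> order_ge k" by (auto simp: order_ge_def)
    then show ?thesis
      using mult_truncate_in_span[of "h * germ_monom i j" k g u v "E + e"] ij uv
      by (simp add: germ_truncate_homogeneous_mult[OF uv h(1)] germ_truncate_monom MC_def mult_ac)
  qed
  have C_A: "SC \<subseteq> germ_vs.span SA"
    using koszul[OF q(1,3)] by (auto simp: SC_def SA_def MA_def)
  have C_B: "SC \<subseteq> germ_vs.span SB"
    using koszul[OF p(1,3), of _ _ q] by (auto simp: SC_def SB_def MB_def mult_ac)
  obtain S where S: "finite S" "card S + card SC \<le> card SA + card SB"
      "germ_vs.span SA \<subseteq> germ_vs.span S" "germ_vs.span SB \<subseteq> germ_vs.span S"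
    using span_union_of_common_independent[of SA SB SC] fin C_indep C_A C_B
    by (auto simp: SA_def SB_def)

  have ideal: "germ_truncate u v D g \<in> germ_vs.span (S \<union> SF)" if gI: "g \<in> I" for g
  proof -
    obtain a b h where g: "g = a * p + b * q + h * f" and ab: "a \<in> order_ge k" "b \<in> order_ge k"
      using gI I by blast
    \<comment> \<open>\<open>h0\<close> collects the terms of \<open>h\<close> of order below
      \<open>k - 1\<close>; the remainder \<open>h1\<close> has order at least
      \<open>k - 1\<close>.\<close>
    define h0 where "h0 = (\<Sum>(i, j)\<in>MF. germ_scale (germ_coeff h i j) (germ_monom i j))"
    define h1 where "h1 = h - h0"
    have "germ_coeff h0 i j = germ_coeff h i j" if "i + j < k - 1" for i j
      using germ_coeff_sum_monom[OF fin(4), of "\<lambda>(i, j). germ_coeff h i j" i j] that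
      by (simp add: h0_def MF_def)
    moreover have "germ_coeff h i j = germ_coeff h0 i j + germ_coeff h1 i j" for i j
      by (simp add: h1_def flip: germ_coeff_add)
    ultimately have h1: "h1 \<in> order_ge (k - 1)"
      by (auto simp: order_ge_def)
    have move: "c + h1 * z \<in> order_ge k" if "c \<in> order_ge k" "z \<in> order_ge 1" for c z
    proof -
      have "h1 * z \<in> order_ge (k - 1 + 1)" using h1 that by (intro order_ge_mult)
      then show ?thesis using that by (intro order_ge_add) (auto simp: order_ge_def)
    qed
    \<comment> \<open>Expanding \<open>h1 * f\<close> by \<open>f = x * p + y * q\<close> moves it
      into the coefficients of \<open>p\<close> and \<open>q\<close>, which keep order at least
      \<open>k\<close>.\<close>
    have "g = p * (a + h1 * x) + q * (b + h1 * y) + h0 * f"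
      unfolding g h1_def f(1) by (simp add: algebra_simps)
    then have "germ_truncate u v D g = germ_truncate u v (E + e2 + e1) (p * (a + h1 * x))
        + germ_truncate u v (E + e1 + e2) (q * (b + h1 * y)) + germ_truncate u v D (h0 * f)"
      by (simp add: germ_truncate_add D_def add_ac)
    also have "\<dots> = p * germ_truncate u v (E + e2) (a + h1 * x)
        + q * germ_truncate u v (E + e1) (b + h1 * y) + germ_truncate u v D (h0 * f)"
      by (simp only: germ_truncate_homogeneous_mult[OF uv p(1)] germ_truncate_homogeneous_mult[OF uv q(1)])
    also have "\<dots> \<in> germ_vs.span (S \<union> SF)"
    proof (intro germ_vs.span_add)
      have mono: "germ_vs.span S \<subseteq> germ_vs.span (S \<union> SF)"
        by (rule germ_vs.span_mono) simp
      show "p * germ_truncate u v (E + e2) (a + h1 * x) \<in> germ_vs.span (S \<union> SF)"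
        using mult_truncate_in_span[OF move[OF ab(1) f(2)], of p u v "E + e2"] S(3) mono
        by (auto simp: SA_def MA_def)
      show "q * germ_truncate u v (E + e1) (b + h1 * y) \<in> germ_vs.span (S \<union> SF)"
        using mult_truncate_in_span[OF move[OF ab(2) f(3)], of q u v "E + e1"] S(4) mono
        by (auto simp: SB_def MB_def)
      have "germ_truncate u v D (h0 * f) =
          (\<Sum>(i, j)\<in>MF. germ_scale (germ_coeff h i j) (germ_truncate u v D (germ_monom i j * f)))"
        by (simp add: h0_def sum_distrib_right germ_scale_mult_left germ_truncate_sum
            germ_truncate_scale case_prod_beta)
      also have "\<dots> \<in> germ_vs.span SF"
        unfolding case_prod_beta
        by (intro germ_vs.span_sum germ_vs.span_scale germ_vs.span_base) (force simp: SF_def)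
      also have "germ_vs.span SF \<subseteq> germ_vs.span (S \<union> SF)"
        by (rule germ_vs.span_mono) simp
      finally show "germ_truncate u v D (h0 * f) \<in> germ_vs.span (S \<union> SF)" .
    qed
    finally show ?thesis .
  qed

  let ?T = "germ_truncate u v D ` B \<union> (S \<union> SF)"
  have all: "germ_truncate u v D g \<in> germ_vs.span ?T" for g
  proof -
    obtain c where "g - (\<Sum>b\<in>B. germ_scale (c b) b) \<in> I"
      using B unfolding quotient_basis_def by blast
    then have "germ_truncate u v D (g - (\<Sum>b\<in>B. germ_scale (c b) b)) \<in> germ_vs.span (S \<union> SF)"
      by (rule ideal)
    also have "\<dots> \<subseteq> germ_vs.span ?T" by (rule germ_vs.span_mono) simp
    finally have 1: "germ_truncate u v D (g - (\<Sum>b\<in>B. germ_scale (c b) b)) \<in> germ_vs.span ?T" .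
    have 2: "germ_truncate u v D (\<Sum>b\<in>B. germ_scale (c b) b) \<in> germ_vs.span ?T"
      unfolding germ_truncate_sum germ_truncate_scale
      by (intro germ_vs.span_sum germ_vs.span_scale germ_vs.span_base) simp
    show ?thesis using germ_vs.span_add[OF 1 2] by (simp flip: germ_truncate_add)
  qed
  \<comment> \<open>The factor 1 lets the independence of monomials be the case \<open>p = 1\<close>
    of \<open>independent_monom_multiples\<close>.\<close>
  let ?M = "(\<lambda>(i, j). 1 * germ_monom i j) ` weighted_box u v D"
  have "?M \<subseteq> germ_vs.span ?T"
  proof clarify
    fix i j assume "(i, j) \<in> weighted_box u v D"
    then show "1 * germ_monom i j \<in> germ_vs.span ?T"
      using all[of "germ_monom i j"] uv by (simp add: germ_truncate_monom)
  qed
  moreover have "germ_vs.independent ?M" "card ?M = card (weighted_box u v D)"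
    by (rule independent_monom_multiples; use uv in simp)+
  ultimately have "card (weighted_box u v D) \<le> card ?T"
    using germ_vs.independent_span_bound[of ?T ?M] fin S(1) by (simp add: SF_def)
  also have "\<dots> \<le> card (germ_truncate u v D ` B) + (card S + card SF)"
    using card_Un_le[of "germ_truncate u v D ` B" "S \<union> SF"] card_Un_le[of S SF] by linarith
  also have "\<dots> \<le> card B + (card S + card MF)"
    using card_image_le[OF fin(5), of "germ_truncate u v D"]
      card_image_le[OF fin(4), of "\<lambda>(i, j). germ_truncate u v D (germ_monom i j * f)"]
    by (simp add: SF_def)
  finally have "card (weighted_box u v D) \<le> card B + (card S + card MF)" .
  moreover have "card SA \<le> card MA" "card SB \<le> card MB"
    using card_image_le[OF fin(1)] card_image_le[OF fin(2)] by (auto simp: SA_def SB_def)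
  ultimately show ?thesis
    using S(2) card_C unfolding D_def MA_def MB_def MC_def MF_def by linarith
qed

section \<open>Nonvanishing of the partial derivatives\<close>

lemma germ_monom_not_unit:
  assumes "0 < i + j"
  shows "\<not> germ_monom i j dvd 1"
proof
  assume "germ_monom i j dvd 1"
  then obtain g where "1 = germ_monom i j * g" ..
  from arg_cong[OF this, of "\<lambda>h. germ_coeff h 0 0"] show False
    using assms by (simp add: germ_coeff_1 germ_coeff_monom_mult split: if_splits)
qed

lemma germ_eq_scale_monom:
  assumes "\<And>i j. germ_coeff g i j \<noteq> 0 \<Longrightarrow> i = a \<and> j = b"
  shows "g = germ_scale (germ_coeff g a b) (germ_monom a b)"
  by (rule germ2_eqI) (use assms in auto)

text \<open>For \<open>m \<ge> 2\<close> the square of the nonunit \<open>germ_monom a b\<close>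
  would be a divisor. The exponents \<open>m * a\<close>, \<open>m * b\<close> cover powers of
  either variable at once.\<close>

lemma squarefree_power_monom_multiple:
  assumes "squarefree (germ_scale c (germ_monom (m * a) (m * b)))" and "0 < a + b"
  shows "m < 2"
proof (rule ccontr)
  assume "\<not> m < 2"
  then obtain n where "m = 2 + n" by (metis le_Suc_ex not_less)
  then have "germ_scale c (germ_monom (m * a) (m * b)) =
      germ_monom a b ^ 2 * germ_scale c (germ_monom (n * a) (n * b))"
    by (simp add: power2_eq_square germ_monom_mult germ_scale_mult_right algebra_simps)
  then have "germ_monom a b ^ 2 dvd germ_scale c (germ_monom (m * a) (m * b))" by simp
  then have "germ_monom a b dvd 1" by (rule squarefreeD[OF assms(1)])
  then show False using germ_monom_not_unit[OF assms(2)] by contradiction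
qed

text \<open>If a derivative vanished, \<open>f\<close> would involve one variable only and, by
  homogeneity, be a single power of it up to a scalar. Squarefreeness leaves the exponents 0 and 1,
  and both are excluded by the singularity at the origin.\<close>

lemma partial_derivatives_nonzero:
  assumes uv: "u > 0" "v > 0" and hom: "germ_homogeneous u v N f"
    and sf: "squarefree f" and sing: "singular_at_0 f"
  shows "germ_dx f \<noteq> 0" "germ_dy f \<noteq> 0"
proof -
  have "f \<noteq> 0" using sf by auto
  then obtain a b where ab: "germ_coeff f a b \<noteq> 0"
    by (metis germ2_eqI germ_coeff_0)
  have low: "germ_coeff f 0 0 = 0" "germ_coeff f (Suc 0) 0 = 0" "germ_coeff f 0 (Suc 0) = 0"
    using sing by (auto simp: singular_at_0_def germ_coeff_dx germ_coeff_dy)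
  show "germ_dx f \<noteq> 0"
  proof
    assume 0: "germ_dx f = 0"
    have i0: "i = 0" if "germ_coeff f i j \<noteq> 0" for i j
    proof (rule ccontr)
      assume "i \<noteq> 0"
      then obtain n where "i = Suc n" by (cases i) auto
      then show False using that arg_cong[OF 0, of "\<lambda>g. germ_coeff g n j"]
        unfolding germ_coeff_dx germ_coeff_0 mult_eq_0_iff of_nat_eq_0_iff by simp
    qed
    have "i = 0 \<and> j = b" if "germ_coeff f i j \<noteq> 0" for i j
      using i0[OF that] i0[OF ab] that ab hom uv unfolding germ_homogeneous_def
      by (metis add_0 mult_0_right mult_left_cancel neq0_conv)
    then have "f = germ_scale (germ_coeff f 0 b) (germ_monom (b * 0) (b * 1))"
      using germ_eq_scale_monom[of f 0 b] by simp
    then have "b < 2"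
      using squarefree_power_monom_multiple[of "germ_coeff f 0 b" b 0 1] sf by simp
    then show False using ab i0[OF ab] low by (auto simp: less_2_cases_iff)
  qed
  show "germ_dy f \<noteq> 0"
  proof
    assume 0: "germ_dy f = 0"
    have j0: "j = 0" if "germ_coeff f i j \<noteq> 0" for i j
    proof (rule ccontr)
      assume "j \<noteq> 0"
      then obtain n where "j = Suc n" by (cases j) auto
      then show False using that arg_cong[OF 0, of "\<lambda>g. germ_coeff g i n"]
        unfolding germ_coeff_dy germ_coeff_0 mult_eq_0_iff of_nat_eq_0_iff by simp
    qed
    have "i = a \<and> j = 0" if "germ_coeff f i j \<noteq> 0" for i j
      using j0[OF that] j0[OF ab] that ab hom uv unfolding germ_homogeneous_def
      by (metis add_0_right mult_0_right mult_left_cancel neq0_conv)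
    then have "f = germ_scale (germ_coeff f a 0) (germ_monom (a * 1) (a * 0))"
      using germ_eq_scale_monom[of f a 0] by simp
    then have "a < 2"
      using squarefree_power_monom_multiple[of "germ_coeff f a 0" a 1 0] sf by simp
    then show False using ab j0[OF ab] low by (auto simp: less_2_cases_iff)
  qed
qed

section \<open>Degrees of the partial derivatives and Euler's relation\<close>

lemma germ_homogeneous_dx:
  assumes "germ_homogeneous u v N f" shows "germ_homogeneous u v (N - u) (germ_dx f)"
  unfolding germ_homogeneous_def
proof (intro allI impI)
  fix i j assume "germ_coeff (germ_dx f) i j \<noteq> 0"
  then have "germ_coeff f (Suc i) j \<noteq> 0" unfolding germ_coeff_dx by auto
  then have "u * Suc i + v * j = N" using assms unfolding germ_homogeneous_def by blast
  \<comment> \<open>A nonzero coefficient forces \<open>u \<le> N\<close>; for \<open>u > N\<close>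
    the derivative is zero and the truncated difference does no harm.\<close>
  then show "u * i + v * j = N - u" by simp
qed

lemma germ_homogeneous_dy:
  assumes "germ_homogeneous u v N f" shows "germ_homogeneous u v (N - v) (germ_dy f)"
  unfolding germ_homogeneous_def
proof (intro allI impI)
  fix i j assume "germ_coeff (germ_dy f) i j \<noteq> 0"
  then have "germ_coeff f i (Suc j) \<noteq> 0" unfolding germ_coeff_dy by auto
  then have "u * i + v * Suc j = N" using assms unfolding germ_homogeneous_def by blast
  then show "u * i + v * j = N - v" by simp
qed

text \<open>This makes \<open>N - u\<close> and \<open>N - v\<close> genuine differences, as the
  computation of the Milnor number requires.\<close>

lemma weight_le_degree:
  assumes "germ_homogeneous u v N f"
  shows "germ_dx f \<noteq> 0 \<Longrightarrow> u \<le> N" "germ_dy f \<noteq> 0 \<Longrightarrow> v \<le> N"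
proof -
  assume "germ_dx f \<noteq> 0"
  then obtain i j where "germ_coeff (germ_dx f) i j \<noteq> 0" by (metis germ2_eqI germ_coeff_0)
  then have "germ_coeff f (Suc i) j \<noteq> 0" unfolding germ_coeff_dx by auto
  then have "u * Suc i + v * j = N" using assms unfolding germ_homogeneous_def by blast
  then show "u \<le> N" by simp
next
  assume "germ_dy f \<noteq> 0"
  then obtain i j where "germ_coeff (germ_dy f) i j \<noteq> 0" by (metis germ2_eqI germ_coeff_0)
  then have "germ_coeff f i (Suc j) \<noteq> 0" unfolding germ_coeff_dy by auto
  then have "u * i + v * Suc j = N" using assms unfolding germ_homogeneous_def by blast
  then show "v \<le> N" by simp
qed

text \<open>Multiplying the derivatives back by their variables scales the coefficient at
  \<open>(i, j)\<close> by \<open>i\<close> and by \<open>j\<close>, and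
  \<open>u * i + v * j = N\<close> wherever it is nonzero.\<close>

lemma euler_relation:
  assumes "germ_homogeneous u v N f" "N > 0"
  shows "f = germ_scale (of_nat u / of_nat N) (germ_monom 1 0) * germ_dx f
           + germ_scale (of_nat v / of_nat N) (germ_monom 0 1) * germ_dy f"
proof (rule germ2_eqI)
  fix i j
  have x: "germ_coeff (germ_monom 1 0 * germ_dx f) i j = of_nat i * germ_coeff f i j"
    unfolding germ_coeff_monom_mult by (cases i) (auto simp: germ_coeff_dx simp del: of_nat_Suc)
  have y: "germ_coeff (germ_monom 0 1 * germ_dy f) i j = of_nat j * germ_coeff f i j"
    unfolding germ_coeff_monom_mult by (cases j) (auto simp: germ_coeff_dy simp del: of_nat_Suc)
  have "germ_coeff f i j = (of_nat (u * i + v * j) / of_nat N) * germ_coeff f i j"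
    using assms unfolding germ_homogeneous_def by (cases "germ_coeff f i j = 0") auto
  also have "\<dots> = (of_nat u / of_nat N) * (of_nat i * germ_coeff f i j)
      + (of_nat v / of_nat N) * (of_nat j * germ_coeff f i j)"
    using assms(2) by (simp add: field_simps)
  finally show "germ_coeff f i j = germ_coeff
      (germ_scale (of_nat u / of_nat N) (germ_monom 1 0) * germ_dx f
       + germ_scale (of_nat v / of_nat N) (germ_monom 0 1) * germ_dy f) i j"
    by (simp only: germ_coeff_add germ_coeff_scale germ_scale_mult_left x y)
qed

section \<open>Order of the derivatives and integer weights\<close>

lemma order_ge_multiplicity: "f \<in> order_ge (multiplicity_at_0 f)"
  unfolding order_ge_def multiplicity_at_0_def using not_less_Least by blast

lemma partial_derivatives_order_ge:
  assumes "f \<in> order_ge m"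
  shows "germ_dx f \<in> order_ge (m - 1)" "germ_dy f \<in> order_ge (m - 1)"
  using assms by (auto simp: order_ge_def germ_coeff_dx germ_coeff_dy)

lemma pos_rat_eq_nat_fraction:
  assumes "(w :: rat) > 0"
  obtains a b :: nat where "a > 0" "b > 0" "w = of_nat a / of_nat b"
proof -
  obtain a b where ab: "quotient_of w = (a, b)" by fastforce
  then have w: "w = of_int a / of_int b" and b: "b > 0"
    by (auto simp: quotient_of_div quotient_of_denom_pos)
  then have a: "a > 0" using assms by (simp add: zero_less_divide_iff)
  show thesis using a b w by (intro that[of "nat a" "nat b"]) auto
qed

lemma weighted_homogeneous_integer_weights:
  assumes "weighted_homogeneous w\<^sub>1 w\<^sub>2 f"
  obtains u v N :: nat where "u > 0" "v > 0" "N > 0" "w\<^sub>1 = of_nat u / of_nat N"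
    "w\<^sub>2 = of_nat v / of_nat N" "germ_homogeneous u v N (germ_of_poly f)"
proof -
  have w: "w\<^sub>1 > 0" "w\<^sub>2 > 0"
    and h: "\<And>i j. coeff (coeff f i) j \<noteq> 0 \<Longrightarrow> w\<^sub>1 * of_nat i + w\<^sub>2 * of_nat j = 1"
    using assms by (auto simp: weighted_homogeneous_def)
  obtain a b where ab: "a > 0" "b > 0" "w\<^sub>1 = of_nat a / of_nat b"
    using w(1) by (rule pos_rat_eq_nat_fraction)
  obtain c d where cd: "c > 0" "d > 0" "w\<^sub>2 = of_nat c / of_nat d"
    using w(2) by (rule pos_rat_eq_nat_fraction)
  show thesis
  \<comment> \<open>The common denominator \<open>b * d\<close> of the two weights becomes the
    degree.\<close>
  proof (rule that[of "a * d" "c * b" "b * d"])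
    show "germ_homogeneous (a * d) (c * b) (b * d) (germ_of_poly f)"
      unfolding germ_homogeneous_def germ_coeff_of_poly
    proof (intro allI impI)
      fix i j assume "coeff (coeff f i) j \<noteq> 0"
      from h[OF this] have "(of_nat (a * d * i + c * b * j) :: rat) = of_nat (b * d)"
        using ab cd by (simp add: field_simps)
      then show "a * d * i + c * b * j = b * d" by (simp only: of_nat_eq_iff)
    qed
  qed (use ab cd in auto)
qed

section \<open>The lower bound for the Tjurina numbers\<close>

theorem theorem6p1:
  fixes f :: "complex poly poly" and w\<^sub>1 w\<^sub>2 :: rat and k :: nat
  assumes "weighted_homogeneous w\<^sub>1 w\<^sub>2 f"
    and "squarefree (germ_of_poly f)"
    and "singular_at_0 (germ_of_poly f)"
    and "of_nat (multiplicity_at_0 (germ_of_poly f)) \<ge> 1 / w\<^sub>1"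
  shows "ereal_of_enat (tjurina_number k (germ_of_poly f))
           \<ge> ereal (of_rat (brieskorn_tjurina k (1 / w\<^sub>1) (1 / w\<^sub>2)))"
proof -
  define F where "F = germ_of_poly f"
  define \<nu> where "\<nu> = multiplicity_at_0 F"
  define I where "I = ideal_add (ideal_mult (ideal_power germ_max_ideal k)
    (ideal_gen {germ_dx F, germ_dy F})) (ideal_gen {F})"
  have tau: "tjurina_number k (germ_of_poly f) = quotient_dim I"
    by (simp add: tjurina_number_def I_def F_def)
  obtain u v N where uv: "u > 0" "v > 0" and N: "N > 0"
    and w: "w\<^sub>1 = of_nat u / of_nat N" "w\<^sub>2 = of_nat v / of_nat N"
    and hom: "germ_homogeneous u v N F"
    using assms(1) unfolding F_def by (rule weighted_homogeneous_integer_weights)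
  have nz: "germ_dx F \<noteq> 0" "germ_dy F \<noteq> 0"
    using partial_derivatives_nonzero[OF uv hom] assms(2,3) by (auto simp: F_def)
  note le = weight_le_degree[OF hom] note uN = le(1)[OF nz(1)] and vN = le(2)[OF nz(2)]
  define a b where "a = 1 / w\<^sub>1" and "b = 1 / w\<^sub>2"
  have a: "a = of_nat N / of_nat u" "a > 0" "a \<le> of_nat \<nu>"
    using w uv N assms(4) by (auto simp: a_def \<nu>_def F_def)
  have \<nu>: "\<nu> \<ge> 1" using a by (cases \<nu>) auto
  \<comment> \<open>The right-hand side is the average second difference for steps
    \<open>N - u\<close> and \<open>N - v\<close>, the degrees of the two partial
    derivatives.\<close>
  have milnor: "(a - 1) * (b - 1) = of_nat (N - u) * of_nat (N - v) / (of_nat u * of_nat v)"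
  proof -
    have "a - 1 = of_nat (N - u) / of_nat u" "b - 1 = of_nat (N - v) / of_nat v"
      using uv uN vN w by (simp_all add: a_def b_def of_nat_diff diff_divide_distrib)
    then show ?thesis by simp
  qed
  show ?thesis
  proof (cases "\<exists>B. quotient_basis I B")
    case False
    then show ?thesis by (simp add: tau quotient_dim_def)
  next
    case True
    define B where "B = (SOME B. quotient_basis I B)"
    have B: "quotient_basis I B" using True unfolding B_def by (rule someI_ex)
    have dim: "quotient_dim I = enat (card B)" using True by (simp add: quotient_dim_def B_def)
    \<comment> \<open>Both derivatives have order at least \<open>\<nu> - 1\<close>, so
      \<open>\<kappa>\<close> is the order from which monomials give Koszul multiples; it is 0 once
      \<open>k < \<nu>\<close>.\<close>
    define \<kappa> where "\<kappa> = k - (\<nu> - 1)"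
    \<comment> \<open>The bound \<open>(u + v) * k\<close> makes the triangles of order below
      \<open>k\<close> fit into every box that occurs.\<close>
    obtain E where E: "(u + v) * k \<le> E"
      and diff: "of_nat (card (weighted_box u v (E + (N - u) + (N - v))))
           - of_nat (card (weighted_box u v (E + (N - u))))
           - of_nat (card (weighted_box u v (E + (N - v)))) + of_nat (card (weighted_box u v E))
         \<ge> (of_nat (N - u) * of_nat (N - v) / (of_nat u * of_nat v) :: rat)"
      using weighted_box_second_difference_ge[OF uv, of "(u + v) * k" "N - u" "N - v"] by blast
    have ineq: "card (weighted_box u v (E + (N - u) + (N - v)))
         + card {(i, j) \<in> weighted_box u v E. \<kappa> \<le> i + j}
      \<le> card B + card {(i, j) \<in> weighted_box u v (E + (N - v)). k \<le> i + j}
         + card {(i, j) \<in> weighted_box u v (E + (N - u)). k \<le> i + j} + card {(i, j). i + j < k - 1}"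
      unfolding \<kappa>_def
    proof (rule quotient_basis_card_ge[OF uv germ_homogeneous_dx[OF hom] nz(1) _
          germ_homogeneous_dy[OF hom] nz(2) _ euler_relation[OF hom N]])
      show "germ_dx F \<in> order_ge (\<nu> - 1)" "germ_dy F \<in> order_ge (\<nu> - 1)"
        unfolding \<nu>_def by (intro partial_derivatives_order_ge order_ge_multiplicity)+
      show "I \<subseteq> {a * germ_dx F + b * germ_dy F + h * F | a b h. a \<in> order_ge k \<and> b \<in> order_ge k}"
        unfolding I_def by (rule tjurina_ideal_subset)
    qed (use B in \<open>auto simp: order_ge_def\<close>)
    have "(u + v) * \<kappa> \<le> (u + v) * k" unfolding \<kappa>_def by (intro mult_left_mono) auto
    then have "2 * card {(i, j) \<in> weighted_box u v E. \<kappa> \<le> i + j} + \<kappa> * (\<kappa> + 1) =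
        2 * card (weighted_box u v E)"
      using E by (intro card_weighted_box_above_diagonal uv) linarith
    moreover have "2 * card {(i, j) \<in> weighted_box u v (E + (N - u)). k \<le> i + j} + k * (k + 1) =
        2 * card (weighted_box u v (E + (N - u)))"
      using E by (intro card_weighted_box_above_diagonal uv) linarith
    moreover have "2 * card {(i, j) \<in> weighted_box u v (E + (N - v)). k \<le> i + j} + k * (k + 1) =
        2 * card (weighted_box u v (E + (N - v)))"
      using E by (intro card_weighted_box_above_diagonal uv) linarith
    moreover have "2 * card {(i, j). i + j < k - 1} + k = k * k"
      unfolding card_triangle by (cases k) auto
    moreover note ineq
    \<comment> \<open>The triangles removed for the two derivatives give k (k + 1) in total; less k
      (k - 1) / 2 for \<open>f\<close>, this is k (k + 3) / 2. The Koszul triangle costs \<kappa>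
      (\<kappa> + 1) / 2.\<close>
    ultimately have "2 * card (weighted_box u v (E + (N - u) + (N - v))) + 2 * card (weighted_box u v E)
        + k * (k + 3) \<le> 2 * card B + 2 * card (weighted_box u v (E + (N - u)))
        + 2 * card (weighted_box u v (E + (N - v))) + \<kappa> * (\<kappa> + 1)"
      unfolding add_mult_distrib2 by linarith
    then have "(of_nat (2 * card (weighted_box u v (E + (N - u) + (N - v))) + 2 * card (weighted_box u v E)
        + k * (k + 3)) :: rat) \<le> of_nat (2 * card B + 2 * card (weighted_box u v (E + (N - u)))
        + 2 * card (weighted_box u v (E + (N - v))) + \<kappa> * (\<kappa> + 1))"
      unfolding of_nat_le_iff .
    then have main: "of_nat (card B) \<ge> (a - 1) * (b - 1) + of_nat k * (of_nat k + 3) / 2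
        - of_nat \<kappa> * (of_nat \<kappa> + 1) / 2"
      using diff unfolding milnor of_nat_add of_nat_mult of_nat_numeral of_nat_1
      by (simp only: ring_distribs add_divide_distrib)
    have "of_nat (card B) \<ge> brieskorn_tjurina k a b"
    proof (cases "of_nat k < a")
      case True
      \<comment> \<open>Here \<open>k < a \<le> \<nu>\<close>, so the correction term
        vanishes.\<close>
      then have "(of_nat k :: rat) < of_nat \<nu>" using a(3) by linarith
      then have "\<kappa> = 0" using \<nu> by (simp add: \<kappa>_def)
      then show ?thesis using main True by (simp add: brieskorn_tjurina_def)
    next
      case False
      \<comment> \<open>A nonzero \<open>\<kappa>\<close> equals \<open>k + 1 - \<nu>\<close>, hence
        is at most \<open>k - a + 1\<close> by \<open>a \<le> \<nu>\<close>; for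
        \<open>\<kappa> = 0\<close> the right-hand side is nonnegative because
        \<open>k \<ge> a\<close>.\<close>
      have "(of_nat \<kappa> * (of_nat \<kappa> + 1) :: rat) \<le> (of_nat k - a + 1) * (of_nat k - a + 2)"
      proof (cases "\<kappa> = 0")
        case True
        then show ?thesis using False by simp
      next
        case k0: False
        then have "\<kappa> + \<nu> = k + 1" using \<nu> by (simp add: \<kappa>_def)
        then have "(of_nat \<kappa> :: rat) + of_nat \<nu> = of_nat k + 1"
          by (metis of_nat_1 of_nat_add)
        then have "(of_nat \<kappa> :: rat) \<le> of_nat k - a + 1" using a(3) by linarith
        then show ?thesis by (intro mult_mono) (use False in auto)
      qed
      then show ?thesis using main False by (simp add: brieskorn_tjurina_def mult.commute)
    qed
    then have "(of_rat (brieskorn_tjurina k a b) :: real) \<le> of_rat (of_nat (card B))"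
      by (simp only: of_rat_less_eq)
    then show ?thesis by (simp add: tau dim a_def b_def)
  qed
qed

end
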